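(* Let $\bm{\gamma}=(\gamma_0,\gamma_1,\ldots)\in\{0,1\}^{\infty}$, let $A\subseteq\mathbb{Z}_{\geq0}$ be finite, and let $m=\mathrm{mex}\,A$. Then $\{{\ast}^{\bm{\gamma}}i:i\in A\}^{\gamma_m}={\ast}^{\bm{\gamma}}m$ if and only if either $\gamma_i=0$ for some $i\le m$, or $\gamma_i=1$ for every $i\in A$.
   Context: Let $\mathcal{B}=\{0,1\}$. Define $\mathbb{I}_0=\{\emptyset\}\times\mathcal{B}$ and $\mathbb{I}_n=2^{\mathbb{I}_{n-1}}\times\mathcal{B}$ for $n\ge1$; a game with activeness is an element of $\mathbb{I}=\bigcup_{n\ge0}\mathbb{I}_n$. A pair $(G,g)$ is written $G^g$; elements of $G$ are its options, $g=1$ meaning active. The outcome $o$ is defined recursively: $o(G^g)=\mathscr{N}$ if $g=1$ and some option has outcome $\mathscr{P}$, and $o(G^g)=\mathscr{P}$ otherwise. The sum is $G^g+H^h=(\{G'^{g'}+H^h:G'^{g'}\in G^g\}\cup\{G^g+H'^{h'}:H'^{h'}\in H^h\})^{\max\{g,h\}}$. $G^g=H^h$ means $o(G^g+X^x)=o(H^h+X^x)$ for all games $X^x$. For $\bm{\gamma}=(\gamma_0,\gamma_1,\ldots)\in\mathcal{B}^\infty$, the nimbers are defined recursively by ${\ast}^{\bm{\gamma}}i=\{{\ast}^{\bm{\gamma}}j:0\le j<i\}^{\gamma_i}$. $\mathrm{mex}\,A=\min(\mathbb{Z}_{\ge0}\setminus A)$. *)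

theory Defs
  imports Main "HOL-Library.FSet"
begin

text \<open>
  Activeness values are booleans, \<open>True\<close> standing for 1 (active) and \<open>False\<close> for 0, so that
  the maximum of two of them is their disjunction. As \<open>\<I>\<^sub>0\<close> is finite, so is every \<open>\<I>\<^sub>n\<close>, and
  every game has a finite set of options; the union of all \<open>\<I>\<^sub>n\<close> is thus the following datatype
  (see \<open>game_in_level\<close> below).
\<close>

datatype game = Game (options: "game fset") (active: bool)

fun level :: "nat \<Rightarrow> game set" where
  "level 0 = {Game {||} b | b. True}"
| "level (Suc n) = {Game F b | F b. fset F \<subseteq> level n}"

lemma level_Suc_mono: "level n \<subseteq> level (Suc n)"
  by (induction n) auto

lemma level_mono: "m \<le> n \<Longrightarrow> level m \<subseteq> level n"
  by (rule lift_Suc_mono_le[of level, OF level_Suc_mono])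

lemma finite_level: "finite (level n)"
proof (induction n)
  case 0
  have "level 0 = range (Game {||})" by auto
  then show ?case by simp
next
  case (Suc n)
  have "level (Suc n) \<subseteq> (\<lambda>(S, b). Game (Abs_fset S) b) ` (Pow (level n) \<times> UNIV)"
  proof
    fix G assume "G \<in> level (Suc n)"
    then obtain F b where "G = Game F b" "fset F \<subseteq> level n" by auto
    then show "G \<in> (\<lambda>(S, b). Game (Abs_fset S) b) ` (Pow (level n) \<times> UNIV)"
      by (intro image_eqI[of _ _ "(fset F, b)"]) (auto simp: fset_inverse)
  qed
  then show ?case using Suc finite_subset by fastforce
qed

lemma game_in_level: "\<exists>n. G \<in> level n"
proof (induction G)
  case (Game F b)
  then obtain k where k: "\<And>H. H \<in> fset F \<Longrightarrow> H \<in> level (k H)" by metis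
  define N where "N = Max (insert 0 (k ` fset F))"
  have "k H \<le> N" if "H \<in> fset F" for H
    unfolding N_def using that by (intro Max_ge) auto
  then have "fset F \<subseteq> level N" using k level_mono by blast
  then have "Game F b \<in> level (Suc N)" by auto
  then show ?case ..
qed

lemma size_option: "G' |\<in>| options G \<Longrightarrow> size G' < size G"
proof (cases G)
  case (Game F b)
  assume "G' |\<in>| options G"
  then have "G' \<in> fset F" using Game by simp
  then have "Suc (size G') \<le> (\<Sum>x\<in>fset F. Suc (size x))"
    by (intro member_le_sum) auto
  then show ?thesis using Game by simp
qed

datatype outcome = \<N> | \<P>

function outcome_of :: "game \<Rightarrow> outcome" where
  "outcome_of G = (if active G \<and> (\<exists>G' \<in> fset (options G). outcome_of G' = \<P>) then \<N> else \<P>)"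
  by auto
termination
  by (relation "measure size") (auto intro: size_option)

declare outcome_of.simps [simp del]

function game_sum :: "game \<Rightarrow> game \<Rightarrow> game" (infixl "\<oplus>" 65) where
  "G \<oplus> H = Game (((\<lambda>G'. G' \<oplus> H) |`| options G) |\<union>| ((\<lambda>H'. G \<oplus> H') |`| options H))
                 (active G \<or> active H)"
  by auto
termination
  by (relation "measure (\<lambda>(G, H). size G + size H)") (auto intro: size_option)

declare game_sum.simps [simp del]

definition game_eq :: "game \<Rightarrow> game \<Rightarrow> bool" (infix "\<doteq>" 50) where
  "G \<doteq> H \<longleftrightarrow> (\<forall>X. outcome_of (G \<oplus> X) = outcome_of (H \<oplus> X))"

text \<open>\<open>Abs_fset\<close> is inverse to \<open>fset\<close> on finite sets, but unspecified on infinite ones.\<close>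

fun nimber :: "(nat \<Rightarrow> bool) \<Rightarrow> nat \<Rightarrow> game" where
  "nimber \<gamma> i = Game (Abs_fset ((\<lambda>j. nimber \<gamma> j) ` {0..<i})) (\<gamma> i)"

declare nimber.simps [simp del]

definition mex :: "nat set \<Rightarrow> nat" where
  "mex A = (LEAST n. n \<notin> A)"

end

theory Submission
  imports Defs
begin

text \<open>
  Write \<open>G\<close> for the game on the left. A surplus option \<open>\<ast>k\<close> of \<open>G\<close> has \<open>k > m\<close>, so moving to it can
  be reverted to \<open>\<ast>m\<close> unless the resulting sum \<open>\<ast>k + X\<close> is inactive. In that case the move wins at
  once, but if \<open>\<gamma>\<^sub>i = 0\<close> for some \<open>i \<le> m\<close>, then so does the move from \<open>\<ast>m + X\<close> to \<open>\<ast>i + X\<close>. Conversely,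
  if \<open>\<gamma>\<^sub>i = 1\<close> for all \<open>i \<le> m\<close> and \<open>\<gamma>\<^sub>k = 0\<close> for some \<open>k \<in> A\<close>, then the inactive game \<open>X\<close> with the
  options of \<open>\<ast>m\<close> distinguishes both sides.
\<close>

lemma active_sum: "active (G \<oplus> H) \<longleftrightarrow> active G \<or> active H"
  by (subst game_sum.simps) simp

lemma fset_options_sum:
  "fset (options (G \<oplus> H)) =
    (\<lambda>G'. G' \<oplus> H) ` fset (options G) \<union> (\<lambda>H'. G \<oplus> H') ` fset (options H)"
  by (subst game_sum.simps) simp

lemma outcome_N_iff:
  "outcome_of G = \<N> \<longleftrightarrow> active G \<and> (\<exists>G' \<in> fset (options G). outcome_of G' = \<P>)"
  by (subst outcome_of.simps) simp

lemma outcome_not_N_iff: "outcome_of G \<noteq> \<N> \<longleftrightarrow> outcome_of G = \<P>"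
  by (cases "outcome_of G") auto

lemma outcome_sum_N_iff:
  "outcome_of (G \<oplus> H) = \<N> \<longleftrightarrow> (active G \<or> active H) \<and>
    ((\<exists>G' \<in> fset (options G). outcome_of (G' \<oplus> H) = \<P>) \<or>
     (\<exists>H' \<in> fset (options H). outcome_of (G \<oplus> H') = \<P>))"
  by (subst outcome_N_iff) (auto simp: active_sum fset_options_sum)

lemma outcome_sum_inactive: "\<not> active G \<Longrightarrow> \<not> active H \<Longrightarrow> outcome_of (G \<oplus> H) = \<P>"
  using outcome_sum_N_iff[of G H] outcome_not_N_iff by auto

text \<open>Mirror strategy: a move to \<open>G'\<close> in one copy is answered by the same move in
  the other, reaching \<open>G' \<oplus> G'\<close>, which is settled by induction.\<close>

lemma outcome_sum_self: "outcome_of (G \<oplus> G) = \<P>"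
proof (induction "size G" arbitrary: G rule: less_induct)
  case less
  have IH: "outcome_of (G' \<oplus> G') = \<P>" if "G' \<in> fset (options G)" for G'
    using less size_option that by blast
  have "outcome_of (G \<oplus> G) \<noteq> \<N>"
  proof
    assume N: "outcome_of (G \<oplus> G) = \<N>"
    \<comment> \<open>The copy left untouched by the first move is active, so it keeps the sum
      active and the mirror reply is legal.\<close>
    then have act: "active G" using outcome_sum_N_iff by blast
    have "outcome_of (G' \<oplus> G) = \<N> \<and> outcome_of (G \<oplus> G') = \<N>" if "G' \<in> fset (options G)" for G'
      using IH[OF that] that act outcome_sum_N_iff by blast
    with N show False using outcome_sum_N_iff[of G G] by auto
  qed
  then show ?case using outcome_not_N_iff by blast
qed

lemma active_nimber [simp]: "active (nimber \<gamma> i) = \<gamma> i"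
  by (subst nimber.simps) simp

lemma fset_options_nimber: "fset (options (nimber \<gamma> i)) = nimber \<gamma> ` {..<i}"
  by (subst nimber.simps) (simp add: Abs_fset_inverse atLeast0LessThan)

lemma mex_notin: "finite A \<Longrightarrow> mex A \<notin> A"
  unfolding mex_def by (metis LeastI ex_new_if_finite infinite_UNIV_nat)

lemma less_mex_in: "i < mex A \<Longrightarrow> i \<in> A"
  unfolding mex_def using not_less_Least by blast

theorem theorem3p50:
  fixes \<gamma> :: "nat \<Rightarrow> bool" and A :: "nat set" and m :: nat
  assumes "finite A"
    and "m = mex A"
  shows "Game (Abs_fset (nimber \<gamma> ` A)) (\<gamma> m) \<doteq> nimber \<gamma> m \<longleftrightarrow>
    (\<exists>i\<le>m. \<not> \<gamma> i) \<or> (\<forall>i\<in>A. \<gamma> i)"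
proof -
  define G where "G = Game (Abs_fset (nimber \<gamma> ` A)) (\<gamma> m)"
  have actG: "active G = \<gamma> m" by (simp add: G_def)
  have optG: "fset (options G) = nimber \<gamma> ` A"
    using assms(1) by (simp add: G_def Abs_fset_inverse)
  have below: "i \<in> A" if "i < m" for i using that assms(2) less_mex_in by blast
  have "m \<notin> A" using assms mex_notin by blast
  have "G \<doteq> nimber \<gamma> m" if cond: "(\<exists>i\<le>m. \<not> \<gamma> i) \<or> (\<forall>i\<in>A. \<gamma> i)"
    unfolding game_eq_def
  proof
    fix X
    show "outcome_of (G \<oplus> X) = outcome_of (nimber \<gamma> m \<oplus> X)"
    \<comment> \<open>Moves in \<open>X\<close> agree on both sides by induction, so only moves in
      the first component need an argument.\<close>
    proof (induction "size X" arbitrary: X rule: less_induct)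
      case less
      have IH: "outcome_of (G \<oplus> X') = outcome_of (nimber \<gamma> m \<oplus> X')"
        if "X' \<in> fset (options X)" for X'
        using less size_option that by blast
      have surplus: "outcome_of (nimber \<gamma> m \<oplus> X) = \<N>"
        if act: "\<gamma> m \<or> active X" and "k \<in> A" and P: "outcome_of (nimber \<gamma> k \<oplus> X) = \<P>" for k
      proof -
        have "k \<noteq> m" using \<open>k \<in> A\<close> \<open>m \<notin> A\<close> by auto
        then consider "k < m" | "m < k" "\<gamma> k \<or> active X" | "\<not> \<gamma> k" "\<not> active X" by linarith
        then show ?thesis
        proof cases
          case 1
          then show ?thesis
            unfolding outcome_sum_N_iff[of "nimber \<gamma> m"] fset_options_nimber
            using act P by auto
        next
          case 2
          \<comment> \<open>The reverting move: \<open>nimber \<gamma> m\<close> is an option of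
            \<open>nimber \<gamma> k\<close>, and an active sum with outcome \<open>\<P>\<close> has
            no option with outcome \<open>\<P>\<close>.\<close>
          have "outcome_of (nimber \<gamma> k \<oplus> X) \<noteq> \<N>" using P by simp
          then have "outcome_of (nimber \<gamma> m \<oplus> X) \<noteq> \<P>"
            unfolding outcome_sum_N_iff[of "nimber \<gamma> k"] fset_options_nimber using 2 by auto
          then show ?thesis using outcome_not_N_iff by blast
        next
          case 3
          then obtain i where "i \<le> m" "\<not> \<gamma> i" using cond \<open>k \<in> A\<close> by auto
          \<comment> \<open>This excludes \<open>i = m\<close>; the strict inequality makes
            \<open>nimber \<gamma> i\<close> an option of \<open>nimber \<gamma> m\<close>.\<close>
          moreover have "\<gamma> m" using act 3 by simp
          ultimately have "i < m" using le_neq_implies_less by blast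
          moreover have "outcome_of (nimber \<gamma> i \<oplus> X) = \<P>"
            using outcome_sum_inactive \<open>\<not> \<gamma> i\<close> 3 by simp
          ultimately show ?thesis
            unfolding outcome_sum_N_iff[of "nimber \<gamma> m"] fset_options_nimber
            using act by auto
        qed
      qed
      have "outcome_of (G \<oplus> X) = \<N> \<longleftrightarrow> outcome_of (nimber \<gamma> m \<oplus> X) = \<N>"
      proof
        assume N: "outcome_of (G \<oplus> X) = \<N>"
        then have act: "\<gamma> m \<or> active X" using outcome_sum_N_iff actG by blast
        from N consider k where "k \<in> A" "outcome_of (nimber \<gamma> k \<oplus> X) = \<P>"
          | X' where "X' \<in> fset (options X)" "outcome_of (G \<oplus> X') = \<P>"
          unfolding outcome_sum_N_iff[of G] optG by blast
        then show "outcome_of (nimber \<gamma> m \<oplus> X) = \<N>"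
        proof cases
          case 1
          then show ?thesis using surplus act by blast
        next
          case 2
          then show ?thesis using IH act outcome_sum_N_iff[of "nimber \<gamma> m" X] by auto
        qed
      next
        assume "outcome_of (nimber \<gamma> m \<oplus> X) = \<N>"
        \<comment> \<open>By \<open>below\<close>, each option of \<open>nimber \<gamma> m\<close>
          is also one of \<open>G\<close>, so a winning move there carries over.\<close>
        then show "outcome_of (G \<oplus> X) = \<N>"
          unfolding outcome_sum_N_iff[of G] outcome_sum_N_iff[of "nimber \<gamma> m"]
            fset_options_nimber optG actG
          using IH below by auto
      qed
      then show ?case using outcome_not_N_iff by metis
    qed
  qed
  moreover have "\<not> G \<doteq> nimber \<gamma> m" if pos: "\<forall>i\<le>m. \<gamma> i" and k: "k \<in> A" "\<not> \<gamma> k" for k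
  proof -
    \<comment> \<open>Being inactive, \<open>X\<close> lets the move to
      \<open>nimber \<gamma> k\<close> end play at once; having the options of
      \<open>nimber \<gamma> m\<close>, it still allows mirroring against that nimber.\<close>
    define X where "X = Game (options (nimber \<gamma> m)) False"
    have actX: "\<not> active X" and optX: "fset (options X) = nimber \<gamma> ` {..<m}"
      by (simp_all add: X_def fset_options_nimber)
    have "outcome_of (nimber \<gamma> k \<oplus> X) = \<P>" using outcome_sum_inactive actX k by simp
    then have "outcome_of (G \<oplus> X) = \<N>"
      unfolding outcome_sum_N_iff[of G] optG actG using pos k by auto
    \<comment> \<open>Mirror reply in \<open>X\<close>, legal since \<open>\<gamma> i\<close>
      holds.\<close>
    moreover have "outcome_of (nimber \<gamma> i \<oplus> X) = \<N>" if "i < m" for i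
      unfolding outcome_sum_N_iff[of "nimber \<gamma> i" X] optX
      using that pos outcome_sum_self by auto
    \<comment> \<open>Mirror reply to a move in \<open>X\<close>, legal since
      \<open>\<gamma> m\<close> holds.\<close>
    moreover have "outcome_of (nimber \<gamma> m \<oplus> nimber \<gamma> i) = \<N>" if "i < m" for i
      unfolding outcome_sum_N_iff[of "nimber \<gamma> m"] fset_options_nimber
      using that pos outcome_sum_self by auto
    ultimately have "outcome_of (nimber \<gamma> m \<oplus> X) \<noteq> \<N>"
      unfolding outcome_sum_N_iff[of "nimber \<gamma> m" X] optX fset_options_nimber by auto
    with \<open>outcome_of (G \<oplus> X) = \<N>\<close> show ?thesis unfolding game_eq_def by metis
  qed
  ultimately show ?thesis unfolding G_def by blast
qed

end
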